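(* For every integer $l\ge 1$, $\chi_{la}(\theta(4l^{[3l+2]}, (4l+1)^{[l]}))=3$, where $\theta(4l^{[3l+2]}, (4l+1)^{[l]})$ is the bridge graph consisting of $3l+2$ internally disjoint $(u,v)$-paths of length $4l$ and $l$ further internally disjoint $(u,v)$-paths of length $4l+1$.
   Context: For a connected graph $G=(V,E)$, a local antimagic labeling is a bijection $f:E\to\{1,\dots,|E|\}$ such that $f^+(x)\neq f^+(y)$ for adjacent vertices $x,y$, where $f^+(x)=\sum_{e\ni x} f(e)$. The number of distinct values of $f^+$ is $c(f)$, and $\chi_{la}(G)$ is the minimum of $c(f)$ over all local antimagic labelings of $G$. A bridge graph $\theta(a_1,\dots,a_s)$ consists of two vertices $u,v$ joined by $s$ internally disjoint $(u,v)$-paths of lengths $a_1,\dots,a_s$. The notation $a^{[n]}$ denotes $n$ entries equal to $a$. *)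

theory Defs
  imports Main
begin

type_synonym 'a graph = "'a set \<times> 'a set set"

abbreviation verts :: "'a graph \<Rightarrow> 'a set" where "verts G \<equiv> fst G"
abbreviation edges :: "'a graph \<Rightarrow> 'a set set" where "edges G \<equiv> snd G"

definition adjacent :: "'a graph \<Rightarrow> 'a \<Rightarrow> 'a \<Rightarrow> bool" where
  "adjacent G x y \<longleftrightarrow> {x, y} \<in> edges G"

definition simple_graph :: "'a graph \<Rightarrow> bool" where
  "simple_graph G \<longleftrightarrow> finite (verts G) \<and> (\<forall>e\<in>edges G. e \<subseteq> verts G \<and> card e = 2)"

definition connected_graph :: "'a graph \<Rightarrow> bool" where
  "connected_graph G \<longleftrightarrow>
     simple_graph G \<and> verts G \<noteq> {} \<and> (\<forall>x\<in>verts G. \<forall>y\<in>verts G. (adjacent G)\<^sup>*\<^sup>* x y)"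

definition induced_label :: "'a graph \<Rightarrow> ('a set \<Rightarrow> nat) \<Rightarrow> 'a \<Rightarrow> nat" where
  "induced_label G f x = (\<Sum>e | e \<in> edges G \<and> x \<in> e. f e)"

definition local_antimagic :: "'a graph \<Rightarrow> ('a set \<Rightarrow> nat) \<Rightarrow> bool" where
  "local_antimagic G f \<longleftrightarrow>
     bij_betw f (edges G) {1..card (edges G)} \<and>
     (\<forall>x\<in>verts G. \<forall>y\<in>verts G. adjacent G x y \<longrightarrow> induced_label G f x \<noteq> induced_label G f y)"

definition num_colors :: "'a graph \<Rightarrow> ('a set \<Rightarrow> nat) \<Rightarrow> nat" where
  "num_colors G f = card (induced_label G f ` verts G)"

text \<open>For a nonempty set of naturals \<open>Inf\<close> is the minimum; \<open>Inf {} = 0\<close>, so a positive value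
  of \<open>chi_la\<close> implies that a local antimagic labeling exists.\<close>

definition chi_la :: "'a graph \<Rightarrow> nat" where
  "chi_la G = Inf (num_colors G ` {f. local_antimagic G f})"

text \<open>The bridge graph of a list of path lengths. The \<open>i\<close>-th path visits
  \<open>path_vertex as i 0 = EndU, Inner i 1, \<dots>, Inner i (as ! i - 1), path_vertex as i (as ! i) = EndV\<close>.
  Lengths are meant to be positive, and since edges form a set, at most one of them should be 1
  (otherwise parallel edges between the two end vertices would be identified).\<close>

datatype bridge_vertex = EndU | EndV | Inner nat nat

definition path_vertex :: "nat list \<Rightarrow> nat \<Rightarrow> nat \<Rightarrow> bridge_vertex" where
  "path_vertex as i j = (if j = 0 then EndU else if j = as ! i then EndV else Inner i j)"

definition bridge_graph :: "nat list \<Rightarrow> bridge_vertex graph" where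
  "bridge_graph as =
     ({EndU, EndV} \<union> {Inner i j | i j. i < length as \<and> 0 < j \<and> j < as ! i},
      {{path_vertex as i j, path_vertex as i (Suc j)} | i j. i < length as \<and> j < as ! i})"

lemma simple_graph_bridge_graph: "simple_graph (bridge_graph as)"
proof -
  have "{Inner i j | i j. i < length as \<and> 0 < j \<and> j < as ! i}
      = (\<Union>i<length as. Inner i ` {0<..<as ! i})" by auto
  then have "finite {Inner i j | i j. i < length as \<and> 0 < j \<and> j < as ! i}" by simp
  then show ?thesis
    by (auto simp: simple_graph_def bridge_graph_def path_vertex_def card_insert_if)
qed

lemma connected_graph_bridge_graph:
  assumes "as \<noteq> []" "\<forall>a\<in>set as. 0 < a"
  shows "connected_graph (bridge_graph as)"
proof -
  let ?R = "(adjacent (bridge_graph as))\<^sup>*\<^sup>*"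
  have *: "?R EndU (path_vertex as i j)" if "i < length as" "j \<le> as ! i" for i j
    using that(2)
  proof (induction j)
    case 0
    show ?case by (simp add: path_vertex_def)
  next
    case (Suc j)
    have "adjacent (bridge_graph as) (path_vertex as i j) (path_vertex as i (Suc j))"
      unfolding adjacent_def bridge_graph_def snd_conv mem_Collect_eq
      using that(1) Suc.prems by (intro exI[of _ i] exI[of _ j]) simp
    with Suc show ?case by (meson Suc_leD rtranclp.rtrancl_into_rtrancl)
  qed
  have V: "?R EndU EndV"
  proof -
    have "0 < as ! 0" using assms by auto
    with *[of 0 "as ! 0"] assms show ?thesis by (simp add: path_vertex_def)
  qed
  have I: "?R EndU (Inner i j)" if "i < length as" "0 < j" "j < as ! i" for i j
    using *[of i j] that by (simp add: path_vertex_def)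
  have U: "?R EndU x" if "x \<in> verts (bridge_graph as)" for x
    using that V I by (auto simp: bridge_graph_def)
  have "symp ?R"
    by (intro symp_rtranclp) (auto simp: symp_def adjacent_def insert_commute)
  then have "?R x y" if "x \<in> verts (bridge_graph as)" "y \<in> verts (bridge_graph as)" for x y
    using U[OF that(1)] U[OF that(2)] by (meson rtranclp_trans sympD)
  then show ?thesis
    using simple_graph_bridge_graph by (auto simp: connected_graph_def bridge_graph_def)
qed

end

theory Submission
  imports Defs
begin

text \<open>
  Paths of length \<open>4l\<close> and \<open>4l + 1\<close> together form an odd cycle, so at least three colours are needed.

  For the upper bound put \<open>d = 8l + 4\<close> and let the inner vertices of every path get the sums
  \<open>A = 16l\<^sup>2 + 8l + 1\<close> and \<open>B = A + d\<close> alternately, starting with \<open>A\<close> next to \<open>u\<close>. A path whose first label is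
  \<open>x\<close> then carries \<open>x, A - x, x + d, A - x - d, x + 2d, \<dots>\<close>, that is, the residue classes of \<open>x\<close> and
  \<open>8l + 5 - x\<close> modulo \<open>d\<close>. There are \<open>2l d + l\<close> edges, so exactly the residues \<open>1, \<dots>, l\<close> occur \<open>2l + 1\<close>
  times; they start the \<open>l\<close> longer paths. The pairs \<open>{r, 8l + 5 - r}\<close> with \<open>l < r \<le> 4l + 2\<close> go to the
  shorter paths, and in each pair we may choose which element is the label at \<open>u\<close>. Taking the larger
  element except for \<open>r = 2l + 2\<close> and \<open>r \<ge> 3l + 2\<close> makes the sum at \<open>u\<close> equal to \<open>B\<close>. The sum at \<open>v\<close> is
  larger than \<open>B\<close> and is the third colour.
\<close>

section \<open>Edge labelings of bridge graphs\<close>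

text \<open>Pairs of path and position replace edges, so labels can be given by formulas and edge
  sums become sums over numbers.\<close>

definition edge_index :: "nat list \<Rightarrow> (nat \<times> nat) set" where
  "edge_index as = (SIGMA i:{..<length as}. {..<as ! i})"

definition path_edge :: "nat list \<Rightarrow> nat \<times> nat \<Rightarrow> bridge_vertex set" where
  "path_edge as = (\<lambda>(i, j). {path_vertex as i j, path_vertex as i (Suc j)})"

lemma finite_edge_index [simp]: "finite (edge_index as)"
  by (simp add: edge_index_def)

lemma card_edge_index: "card (edge_index as) = sum_list as"
  by (simp add: edge_index_def sum_list_sum_nth atLeast0LessThan)

lemma edges_bridge_graph: "edges (bridge_graph as) = path_edge as ` edge_index as"
  by (auto simp: bridge_graph_def path_edge_def edge_index_def image_iff)

lemma verts_bridge_graph_cases: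
  assumes "x \<in> verts (bridge_graph as)"
  obtains "x = EndU" | "x = EndV"
    | i j where "x = Inner i j" "i < length as" "0 < j" "j < as ! i"
  using assms by (auto simp: bridge_graph_def)

lemma path_vertex_in_verts:
  assumes "i < length as" "j \<le> as ! i"
  shows "path_vertex as i j \<in> verts (bridge_graph as)"
  using assms by (auto simp: bridge_graph_def path_vertex_def)

lemma adjacent_path_vertex:
  assumes "i < length as" "j < as ! i"
  shows "adjacent (bridge_graph as) (path_vertex as i j) (path_vertex as i (Suc j))"
  using assms unfolding adjacent_def bridge_graph_def by auto

text \<open>On a path of length at least 2 every edge has an inner vertex, which reveals the path;
  two paths of length 1 would share the edge between \<open>EndU\<close> and
  \<open>EndV\<close>.\<close>

lemma inj_on_path_edge:
  assumes "\<forall>a\<in>set as. 2 \<le> a"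
  shows "inj_on (path_edge as) (edge_index as)"
proof (rule inj_onI)
  fix p q assume p: "p \<in> edge_index as" and q: "q \<in> edge_index as"
    and eq: "path_edge as p = path_edge as q"
  obtain i j i' j' where [simp]: "p = (i, j)" "q = (i', j')" by fastforce
  have "2 \<le> as ! i" "2 \<le> as ! i'"
    using assms p q by (auto simp: edge_index_def)
  then show "p = q"
    using p q eq
    by (auto simp: edge_index_def path_edge_def path_vertex_def doubleton_eq_iff split: if_splits)
qed

lemma obtain_edge_labeling:
  assumes "\<forall>a\<in>set as. 2 \<le> a"
  obtains f where "\<forall>p\<in>edge_index as. f (path_edge as p) = g p"
proof
  show "\<forall>p\<in>edge_index as. (g \<circ> inv_into (edge_index as) (path_edge as)) (path_edge as p) = g p"
    using inv_into_f_f[OF inj_on_path_edge[OF assms]] by simp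
qed

context
  fixes as :: "nat list" and f :: "bridge_vertex set \<Rightarrow> nat" and g :: "nat \<times> nat \<Rightarrow> nat"
  assumes len: "\<forall>a\<in>set as. 2 \<le> a"
    and f: "\<forall>p\<in>edge_index as. f (path_edge as p) = g p"
begin

lemma induced_label_bridge_graph:
  "induced_label (bridge_graph as) f x = (\<Sum>p | p \<in> edge_index as \<and> x \<in> path_edge as p. g p)"
proof -
  have eq: "{e \<in> edges (bridge_graph as). x \<in> e}
      = path_edge as ` {p \<in> edge_index as. x \<in> path_edge as p}"
    by (auto simp: edges_bridge_graph)
  show ?thesis
    unfolding induced_label_def eq
    by (subst sum.reindex)
      (auto intro: inj_on_subset[OF inj_on_path_edge[OF len]] simp: f intro!: sum.cong)
qed

lemma induced_label_EndU:
  "induced_label (bridge_graph as) f EndU = (\<Sum>i<length as. g (i, 0))"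
proof -
  have "2 \<le> as ! i" if "i < length as" for i
    using len that by simp
  then have "{p \<in> edge_index as. EndU \<in> path_edge as p} = (\<lambda>i. (i, 0)) ` {..<length as}"
    by (fastforce simp: edge_index_def path_edge_def path_vertex_def split: if_splits)
  then show ?thesis
    by (simp add: induced_label_bridge_graph sum.reindex inj_on_def)
qed

lemma induced_label_EndV:
  "induced_label (bridge_graph as) f EndV = (\<Sum>i<length as. g (i, as ! i - 1))"
proof -
  have "2 \<le> as ! i" if "i < length as" for i
    using len that by simp
  then have "{p \<in> edge_index as. EndV \<in> path_edge as p} = (\<lambda>i. (i, as ! i - 1)) ` {..<length as}"
    by (fastforce simp: edge_index_def path_edge_def path_vertex_def split: if_splits)
  then show ?thesis
    by (simp add: induced_label_bridge_graph sum.reindex inj_on_def)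
qed

lemma induced_label_Inner:
  assumes "i < length as" "0 < j" "j < as ! i"
  shows "induced_label (bridge_graph as) f (Inner i j) = g (i, j - 1) + g (i, j)"
proof -
  have "{p \<in> edge_index as. Inner i j \<in> path_edge as p} = {(i, j - 1), (i, j)}"
    using assms by (auto simp: edge_index_def path_edge_def path_vertex_def split: if_splits)
  then show ?thesis
    using assms by (simp add: induced_label_bridge_graph)
qed

text \<open>Only the image of \<open>g\<close> needs checking: there are as many edges as labels, so
  a surjection is injective.\<close>

lemma bij_betw_edges_bridge_graph:
  assumes "g ` edge_index as = {1..sum_list as}"
  shows "bij_betw f (edges (bridge_graph as)) {1..card (edges (bridge_graph as))}"
proof -
  have card: "card (edges (bridge_graph as)) = sum_list as"
    by (simp add: edges_bridge_graph card_image[OF inj_on_path_edge[OF len]] card_edge_index)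
  have img: "f ` edges (bridge_graph as) = {1..sum_list as}"
    using assms by (simp add: edges_bridge_graph image_image f)
  have "inj_on f (edges (bridge_graph as))"
    by (rule eq_card_imp_inj_on) (simp add: edges_bridge_graph, simp add: img card)
  with img card show ?thesis
    by (simp add: bij_betw_def)
qed

end

text \<open>With at most two colours, the colours alternate along every path. The even path then
  gives \<open>EndV\<close> the colour of \<open>EndU\<close>, while the odd path gives it the other
  one.\<close>

lemma num_colors_ge_3_if_odd_cycle:
  assumes f: "local_antimagic (bridge_graph as) f"
    and i: "i < length as" "even (as ! i)" "0 < as ! i" and k: "k < length as" "odd (as ! k)"
  shows "3 \<le> num_colors (bridge_graph as) f"
proof (rule ccontr)
  assume "\<not> ?thesis"
  then have le2: "card (induced_label (bridge_graph as) f ` verts (bridge_graph as)) \<le> 2"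
    by (simp add: num_colors_def)
  define c where "c = induced_label (bridge_graph as) f"
  have fin: "finite (c ` verts (bridge_graph as))"
    using simple_graph_bridge_graph[of as] by (simp add: simple_graph_def)
  have two: "c x = c z"
    if "x \<in> verts (bridge_graph as)" "y \<in> verts (bridge_graph as)" "z \<in> verts (bridge_graph as)"
      "c x \<noteq> c y" "c y \<noteq> c z" for x y z
  proof (rule ccontr)
    assume "c x \<noteq> c z"
    then have "card {c x, c y, c z} = 3" using that by auto
    moreover have "card {c x, c y, c z} \<le> card (c ` verts (bridge_graph as))"
      using that by (intro card_mono fin) auto
    ultimately show False using le2 by (simp add: c_def)
  qed
  have step: "c (path_vertex as i j) \<noteq> c (path_vertex as i (Suc j))"
    if "i < length as" "j < as ! i" for i j
    using f that adjacent_path_vertex[OF that] path_vertex_in_verts[of i as j]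
      path_vertex_in_verts[of i as "Suc j"]
    by (auto simp: local_antimagic_def c_def)
  have alt: "c (path_vertex as i j) = c EndU \<longleftrightarrow> even j"
    if i: "i < length as" and "j \<le> as ! i" for i j
    using that(2)
  proof (induction j)
    case 0
    show ?case by (simp add: path_vertex_def)
  next
    case (Suc j)
    have U: "EndU \<in> verts (bridge_graph as)" by (simp add: bridge_graph_def)
    show ?case
      using Suc step[OF i, of j] two[OF U path_vertex_in_verts[OF i, of j]
          path_vertex_in_verts[OF i, of "Suc j"]]
      by (metis Suc_leD Suc_le_lessD even_Suc)
  qed
  \<comment> \<open>Both lengths must be positive for the last vertex of the path to be
    \<open>EndV\<close>, since \<open>path_vertex\<close> tests position 0 first.\<close>
  have "0 < as ! k" using k(2) by (rule odd_pos)
  then show False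
    using alt[OF i(1) order_refl] alt[OF k(1) order_refl] i k by (simp add: path_vertex_def)
qed

section \<open>The labeling\<close>

text \<open>A short path \<open>i\<close> owns the pair of \<open>r = l + 1 + i\<close> and
  \<open>8 * l + 5 - r = 7 * l + 4 - i\<close>; the exceptions \<open>r = 2 * l + 2\<close> and
  \<open>r \<ge> 3 * l + 2\<close> become \<open>i = l + 1\<close> and
  \<open>i \<ge> 2 * l + 1\<close>. The long paths come last and start with
  \<open>1, ..., l\<close>.\<close>

definition first_label :: "nat \<Rightarrow> nat \<Rightarrow> nat" where
  "first_label l i =
     (if i < 3 * l + 2 then if i = l + 1 \<or> 2 * l + 1 \<le> i then l + 1 + i else 7 * l + 4 - i
      else i - (3 * l + 1))"

definition path_label :: "nat \<Rightarrow> nat \<times> nat \<Rightarrow> nat" where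
  "path_label l = (\<lambda>(i, j).
     if even j then first_label l i + (j div 2) * (8 * l + 4)
     else 16 * l\<^sup>2 + 8 * l + 1 - first_label l i - (j div 2) * (8 * l + 4))"

lemma first_label_bounds:
  assumes "i < 4 * l + 2"
  shows "1 \<le> first_label l i" "first_label l i \<le> 7 * l + 4"
    "i \<ge> 3 * l + 2 \<Longrightarrow> first_label l i \<le> l" "i < 3 * l + 2 \<Longrightarrow> l + 1 \<le> first_label l i"
  using assms by (auto simp: first_label_def)

lemma sum_first_label:
  assumes "1 \<le> l"
  shows "(\<Sum>i<4 * l + 2. first_label l i) = 16 * l\<^sup>2 + 16 * l + 5"
proof -
  \<comment> \<open>The progressions are summed over the integers and doubled, to avoid truncated
    subtraction and division.\<close>
  have ap: "2 * (\<Sum>i<n. c + s * int i) = int n * (2 * c + s * (int n - 1))" for n c s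
    by (induction n) (auto simp: algebra_simps)
  have shift: "(\<Sum>i<m + n. h i) = (\<Sum>i<m. h i) + (\<Sum>i<n. h (m + i))" for m n and h :: "nat \<Rightarrow> int"
    by (induction n) auto
  let ?x = "\<lambda>i. int (first_label l i)"
  \<comment> \<open>The exceptional index \<open>l + 1\<close> carries \<open>2 * l + 2\<close> in
    place of \<open>6 * l + 3\<close>, a loss of \<open>4 * l + 1\<close>. It lies in this block
    because \<open>1 \<le> l\<close>.\<close>
  have 1: "(\<Sum>i<2 * l + 1. ?x i)
      = (\<Sum>i<2 * l + 1. (7 * int l + 4) + (-1) * int i) - (4 * int l + 1)"
  proof -
    have "(\<Sum>i<2 * l + 1. ?x i)
        = (\<Sum>i<2 * l + 1. ((7 * int l + 4) + (-1) * int i)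
            - (if i = l + 1 then 4 * int l + 1 else 0))"
      by (intro sum.cong) (auto simp: first_label_def of_nat_diff)
    with assms show ?thesis by (simp add: sum_subtractf sum.delta)
  qed
  have 2: "(\<Sum>i<l + 1. ?x (2 * l + 1 + i)) = (\<Sum>i<l + 1. (3 * int l + 2) + 1 * int i)"
    by (intro sum.cong) (auto simp: first_label_def)
  have 3: "(\<Sum>i<l. ?x (3 * l + 2 + i)) = (\<Sum>i<l. 1 + 1 * int i)"
    by (intro sum.cong) (auto simp: first_label_def)
  have "(\<Sum>i<4 * l + 2. ?x i)
      = (\<Sum>i<2 * l + 1. ?x i) + (\<Sum>i<l + 1. ?x (2 * l + 1 + i)) + (\<Sum>i<l. ?x (3 * l + 2 + i))"
    using shift[of ?x "3 * l + 2" l] shift[of ?x "2 * l + 1" "l + 1"]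
    by (simp add: algebra_simps)
  moreover have "2 * (\<Sum>i<2 * l + 1. ?x i) + 2 * (\<Sum>i<l + 1. ?x (2 * l + 1 + i))
      + 2 * (\<Sum>i<l. ?x (3 * l + 2 + i)) = 2 * int (16 * l\<^sup>2 + 16 * l + 5)"
    unfolding 1 2 3 right_diff_distrib ap by (simp add: power2_eq_square algebra_simps)
  ultimately have "int (\<Sum>i<4 * l + 2. first_label l i) = int (16 * l\<^sup>2 + 16 * l + 5)"
    by simp
  then show ?thesis by linarith
qed

text \<open>Since \<open>A = 2 * l * d + 1\<close>, the label \<open>A - x - k * d\<close> lies in
  the class of \<open>d + 1 - x\<close>, with the quotient falling as \<open>k\<close> grows. This
  form also shows that the subtractions in \<open>path_label\<close> do not truncate.\<close>

lemma path_label_odd: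
  assumes "i < 4 * l + 2" "k < 2 * l"
  shows "path_label l (i, 2 * k + 1) = 8 * l + 5 - first_label l i + (2 * l - 1 - k) * (8 * l + 4)"
proof -
  \<comment> \<open>With \<open>t\<close> for \<open>2 * l - 1 - k\<close>, the number
    \<open>A\<close> is linear in the products \<open>k * d\<close> and \<open>t * d\<close>, so
    linear arithmetic suffices.\<close>
  obtain t where t: "2 * l = k + t + 1"
    using assms(2) less_iff_Suc_add[of k "2 * l"] by auto
  have "16 * l\<^sup>2 + 8 * l = (2 * l) * (8 * l + 4)"
    by (simp add: power2_eq_square algebra_simps)
  also have "\<dots> = (k + t + 1) * (8 * l + 4)"
    by (simp only: t)
  finally have "16 * l\<^sup>2 + 8 * l = k * (8 * l + 4) + t * (8 * l + 4) + (8 * l + 4)"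
    by (simp only: distrib_right mult_1)
  moreover have "2 * l - 1 - k = t" using t by simp
  ultimately show ?thesis
    using first_label_bounds(2)[OF assms(1)] by (simp add: path_label_def)
qed

lemma path_label_even: "path_label l (i, 2 * k) = first_label l i + k * (8 * l + 4)"
  by (simp add: path_label_def)

text \<open>The first label and the multiples of \<open>d\<close> cancel, except that after an odd
  position the next label has gained one more \<open>d\<close>: hence \<open>A\<close> and
  \<open>B = A + d\<close>.\<close>

lemma path_label_consecutive:
  assumes "i < 4 * l + 2" "j < 4 * l"
  shows "path_label l (i, j) + path_label l (i, Suc j)
    = (if even j then 16 * l\<^sup>2 + 8 * l + 1 else 16 * l\<^sup>2 + 16 * l + 5)"
proof -
  define k where "k = j div 2"
  have k: "k < 2 * l" using assms(2) by (auto simp: k_def)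
  obtain t where t: "2 * l = k + t + 1"
    using k less_iff_Suc_add[of k "2 * l"] by auto
  have "16 * l\<^sup>2 + 8 * l = (2 * l) * (8 * l + 4)"
    by (simp add: power2_eq_square algebra_simps)
  also have "\<dots> = (k + t + 1) * (8 * l + 4)"
    by (simp only: t)
  finally have A: "16 * l\<^sup>2 + 8 * l = k * (8 * l + 4) + t * (8 * l + 4) + (8 * l + 4)"
    by (simp only: distrib_right mult_1)
  have t': "2 * l - 1 - k = t" using t by simp
  note odd = path_label_odd[OF assms(1) k, unfolded t']
  note x = first_label_bounds(2)[OF assms(1)]
  show ?thesis
  proof (cases "even j")
    case True
    then have "j = 2 * k" by (simp add: k_def)
    with True A odd x path_label_even[of l i k] show ?thesis by simp
  next
    case False
    then have "j = 2 * k + 1" by (simp add: k_def)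
    then have "path_label l (i, Suc j) = first_label l i + k * (8 * l + 4) + (8 * l + 4)"
      using path_label_even[of l i "Suc k"] by simp
    with False \<open>j = 2 * k + 1\<close> A odd x show ?thesis by simp
  qed
qed

section \<open>The path lengths and the set of labels used\<close>

definition theta_lengths :: "nat \<Rightarrow> nat list" where
  "theta_lengths l = replicate (3 * l + 2) (4 * l) @ replicate l (4 * l + 1)"

lemma length_theta_lengths: "length (theta_lengths l) = 4 * l + 2"
  by (simp add: theta_lengths_def)

lemma nth_theta_lengths:
  assumes "i < 4 * l + 2"
  shows "theta_lengths l ! i = (if i < 3 * l + 2 then 4 * l else 4 * l + 1)"
  unfolding theta_lengths_def using assms
  by (auto simp: nth_append simp del: replicate_Suc add_2_eq_Suc')

lemma sum_list_theta_lengths: "sum_list (theta_lengths l) = 2 * l * (8 * l + 4) + l"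
  by (simp only: theta_lengths_def sum_list_append sum_list_replicate) (simp add: algebra_simps)

lemma edge_index_theta:
  "(i, j) \<in> edge_index (theta_lengths l)
    \<longleftrightarrow> i < 4 * l + 2 \<and> (j < 4 * l \<or> j = 4 * l \<and> 3 * l + 2 \<le> i)"
  by (auto simp: edge_index_def nth_theta_lengths length_theta_lengths split: if_splits)

text \<open>Even positions sweep the class of the first label \<open>x\<close>, odd ones that of
  \<open>d + 1 - x\<close>. The top \<open>l\<close> labels are the final edges of the long
  paths.\<close>

lemma path_label_image:
  "path_label l ` edge_index (theta_lengths l) = {1..2 * l * (8 * l + 4) + l}"
proof (intro equalityI subsetI)
  fix N assume "N \<in> path_label l ` edge_index (theta_lengths l)"
  then obtain i j where N: "N = path_label l (i, j)" and "(i, j) \<in> edge_index (theta_lengths l)"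
    by auto
  then have i: "i < 4 * l + 2" and j: "j < 4 * l \<or> j = 4 * l \<and> 3 * l + 2 \<le> i"
    by (auto simp only: edge_index_theta)
  note x = first_label_bounds[OF i]
  have mult: "k * (8 * l + 4) + (8 * l + 4) \<le> 2 * l * (8 * l + 4)" if "k < 2 * l" for k
    using mult_le_mono1[of "Suc k" "2 * l" "8 * l + 4"] that by simp
  show "N \<in> {1..2 * l * (8 * l + 4) + l}"
  proof (cases "even j")
    case True
    then obtain k where k: "j = 2 * k" by auto
    show ?thesis
    proof (cases "k < 2 * l")
      case True
      then show ?thesis using mult[OF True] x by (simp add: N k path_label_even)
    next
      case False
      then have "k = 2 * l" "3 * l + 2 \<le> i" using j k by auto
      then show ?thesis using x path_label_even[of l i "2 * l"] by (simp add: N k)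
    qed
  next
    case False
    then obtain k where k: "j = 2 * k + 1" by (rule oddE)
    then have "k < 2 * l" using j by auto
    define m where "m = (2 * l - 1 - k) * (8 * l + 4)"
    have "N = 8 * l + 5 - first_label l i + m"
      unfolding N k m_def by (rule path_label_odd[OF i \<open>k < 2 * l\<close>])
    moreover have "m + (8 * l + 4) \<le> 2 * l * (8 * l + 4)"
      unfolding m_def by (rule mult) (use \<open>k < 2 * l\<close> in simp)
    ultimately show ?thesis
      using x unfolding atLeastAtMost_iff by linarith
  qed
next
  fix N assume N: "N \<in> {1..2 * l * (8 * l + 4) + l}"
  \<comment> \<open>The shift by 1 makes the residues run over \<open>1, ..., d\<close> instead of
    \<open>0, ..., d - 1\<close>.\<close>
  define q where "q = (N - 1) div (8 * l + 4)"
  define r where "r = (N - 1) mod (8 * l + 4) + 1"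
  have Nqr: "N = r + q * (8 * l + 4)"
    using N div_mult_mod_eq[of "N - 1" "8 * l + 4"]
    unfolding q_def r_def atLeastAtMost_iff by linarith
  have r: "1 \<le> r" "r \<le> 8 * l + 4"
    by (auto simp: r_def Suc_leI)
  have q: "q < 2 * l \<or> q = 2 * l \<and> r \<le> l"
  proof -
    have "q < 2 * l \<or> q = 2 * l \<or> 2 * l + 1 \<le> q" by linarith
    then show ?thesis
      using N Nqr mult_le_mono1[of "2 * l + 1" q "8 * l + 4"] by (auto simp: distrib_right)
  qed
  \<comment> \<open>The quotient \<open>2 * l\<close> occurs only for \<open>r \<le> l\<close>, at
    position \<open>4 * l\<close>, which only long paths have; the side conditions on
    \<open>r\<close> record this. The witnesses treat \<open>r\<close> in turn as first label of a
    long path, smaller and larger element of a short pair, and partner of a long first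
    label.\<close>
  have "\<exists>i<4 * l + 2. (first_label l i = r \<or> 8 * l + 5 - first_label l i = r \<and> l < r)
      \<and> (r \<le> l \<longrightarrow> 3 * l + 2 \<le> i)"
  proof -
    consider "r \<le> l" | "l < r" "r \<le> 4 * l + 2" | "4 * l + 2 < r" "r \<le> 7 * l + 4" | "7 * l + 4 < r"
      by linarith
    then show ?thesis
    proof cases
      case 1
      with r show ?thesis by (intro exI[of _ "r + (3 * l + 1)"]) (auto simp: first_label_def)
    next
      case 2
      with r show ?thesis by (intro exI[of _ "r - (l + 1)"]) (auto simp: first_label_def)
    next
      case 3
      with r show ?thesis by (intro exI[of _ "7 * l + 4 - r"]) (auto simp: first_label_def)
    next
      case 4
      with r show ?thesis by (intro exI[of _ "11 * l + 6 - r"]) (auto simp: first_label_def)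
    qed
  qed
  then obtain i where i: "i < 4 * l + 2" "r \<le> l \<longrightarrow> 3 * l + 2 \<le> i"
    and "first_label l i = r \<or> 8 * l + 5 - first_label l i = r \<and> l < r"
    by auto
  then consider "first_label l i = r" | "8 * l + 5 - first_label l i = r" "l < r" by auto
  then show "N \<in> path_label l ` edge_index (theta_lengths l)"
  proof cases
    case 1
    have "(i, 2 * q) \<in> edge_index (theta_lengths l)"
      unfolding edge_index_theta using i q by auto
    then show ?thesis
      using 1 Nqr path_label_even[of l i q] by (metis image_eqI)
  next
    case 2
    then have q': "q < 2 * l" using q by auto
    \<comment> \<open>Quotients decrease along odd positions, so the order is reversed.\<close>
    define k where "k = 2 * l - 1 - q"
    have k: "k < 2 * l" "2 * l - 1 - k = q" using q' by (auto simp: k_def)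
    have "(i, 2 * k + 1) \<in> edge_index (theta_lengths l)"
      unfolding edge_index_theta using i k by auto
    moreover have "path_label l (i, 2 * k + 1) = N"
      unfolding path_label_odd[OF i(1) k(1)] k(2) 2(1) Nqr ..
    ultimately show ?thesis by (metis image_eqI)
  qed
qed

text \<open>First and last label are added path by path: exactly \<open>d + 1\<close> on a short
  path, at least \<open>2 * l * d + 2\<close> on a long one. The total exceeds \<open>2 * B\<close>,
  and the first labels contribute exactly \<open>B\<close>.\<close>

lemma sum_last_label_gt:
  assumes "1 \<le> l"
  shows "16 * l\<^sup>2 + 16 * l + 5 < (\<Sum>i<4 * l + 2. path_label l (i, theta_lengths l ! i - 1))"
proof -
  let ?s = "\<lambda>i. first_label l i + path_label l (i, theta_lengths l ! i - 1)"
  have short: "?s i = 8 * l + 5" if "i < 3 * l + 2" for i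
  proof -
    \<comment> \<open>The last position of a short path is odd, with quotient 0.\<close>
    have j: "4 * l - 1 = 2 * (2 * l - 1) + 1" using assms by simp
    have "path_label l (i, 4 * l - 1) = 8 * l + 5 - first_label l i"
      unfolding j using path_label_odd[of i l "2 * l - 1"] assms that by simp
    moreover have "first_label l i \<le> 7 * l + 4"
      using first_label_bounds(2)[of i l] that by simp
    ultimately show ?thesis
      using that by (simp add: nth_theta_lengths)
  qed
  have long: "2 * l * (8 * l + 4) + 2 \<le> ?s i" if "i < 4 * l + 2" "3 * l + 2 \<le> i" for i
    using that path_label_even[of l i "2 * l"] first_label_bounds(1)[OF that(1)]
    by (simp add: nth_theta_lengths)
  have "2 * (16 * l\<^sup>2 + 16 * l + 5) < (3 * l + 2) * (8 * l + 5) + l * (2 * l * (8 * l + 4) + 2)"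
  proof -
    have "(3 * l + 2) * (8 * l + 5) + l * (2 * l * (8 * l + 4) + 2)
        = 2 * (16 * l\<^sup>2 + 16 * l + 5) + l * (16 * l\<^sup>2 + 1)"
      by (simp add: power2_eq_square algebra_simps)
    then show ?thesis using assms by simp
  qed
  also have "\<dots> = (\<Sum>i<3 * l + 2. 8 * l + 5) + (\<Sum>i=3 * l + 2..<4 * l + 2. 2 * l * (8 * l + 4) + 2)"
    by simp
  also have "\<dots> \<le> (\<Sum>i<3 * l + 2. ?s i) + (\<Sum>i=3 * l + 2..<4 * l + 2. ?s i)"
  proof (intro add_mono[OF sum_mono sum_mono])
    show "8 * l + 5 \<le> ?s i" if "i \<in> {..<3 * l + 2}" for i
      using short[of i] that by simp
    show "2 * l * (8 * l + 4) + 2 \<le> ?s i" if "i \<in> {3 * l + 2..<4 * l + 2}" for i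
      using long[of i] that by simp
  qed
  also have "\<dots> = (\<Sum>i<4 * l + 2. ?s i)"
    by (simp only: lessThan_atLeast0) (rule sum.atLeastLessThan_concat, auto)
  also have "\<dots> = 16 * l\<^sup>2 + 16 * l + 5 + (\<Sum>i<4 * l + 2. path_label l (i, theta_lengths l ! i - 1))"
    by (simp only: sum.distrib sum_first_label[OF assms])
  finally show ?thesis unfolding mult_2 by (simp only: add_less_cancel_left)
qed

section \<open>Both bounds combined\<close>

theorem theorem4p1:
  fixes l :: nat
  assumes "1 \<le> l"
  shows "chi_la (bridge_graph (replicate (3 * l + 2) (4 * l) @ replicate l (4 * l + 1))) = 3"
proof -
  let ?as = "theta_lengths l" and ?G = "bridge_graph (theta_lengths l)"
  \<comment> \<open>Path 0 is a short path of even length and path \<open>3 * l + 2\<close> is the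
    first long one, of odd length; it exists because \<open>1 \<le> l\<close>.\<close>
  have ge: "3 \<le> num_colors ?G f" if "local_antimagic ?G f" for f
    using that assms
    by (intro num_colors_ge_3_if_odd_cycle[where i = 0 and k = "3 * l + 2"])
      (auto simp: nth_theta_lengths length_theta_lengths split: if_splits)
  have len: "\<forall>a\<in>set ?as. 2 \<le> a" using assms by (auto simp: theta_lengths_def)
  obtain f where f: "\<forall>p\<in>edge_index ?as. f (path_edge ?as p) = path_label l p"
    using obtain_edge_labeling[OF len, of "path_label l"] by blast
  define A B where "A = 16 * l\<^sup>2 + 8 * l + 1" and "B = 16 * l\<^sup>2 + 16 * l + 5"
  define C where "C = induced_label ?G f EndV"
  have "A < B" by (simp add: A_def B_def)
  have "B < C"
    using sum_last_label_gt[OF assms]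
    unfolding C_def B_def induced_label_EndV[OF len f] length_theta_lengths .
  have U: "induced_label ?G f EndU = B"
    using sum_first_label[OF assms] path_label_even[of l _ 0]
    unfolding B_def induced_label_EndU[OF len f] length_theta_lengths by simp
  have inner: "induced_label ?G f (Inner i j) = (if odd j then A else B)"
    if "i < 4 * l + 2" "0 < j" "j < ?as ! i" for i j
  proof -
    have "j - 1 < 4 * l" using that by (auto simp: nth_theta_lengths split: if_splits)
    then show ?thesis
      using induced_label_Inner[OF len f, of i j] length_theta_lengths[of l] path_label_consecutive[OF that(1), of "j - 1"] that
      by (auto simp: A_def B_def)
  qed
  \<comment> \<open>\<open>EndU\<close> fits the alternation as position 0, since its sum is also
    \<open>B\<close>; only \<open>EndV\<close> breaks it.\<close>
  have label: "induced_label ?G f (path_vertex ?as i j)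
      = (if j = ?as ! i then C else if odd j then A else B)"
    if "i < 4 * l + 2" "j \<le> ?as ! i" for i j
  proof -
    have "?as ! i \<noteq> 0" using that(1) assms by (simp add: nth_theta_lengths)
    with that U inner[of i j] C_def show ?thesis by (auto simp: path_vertex_def)
  qed
  \<comment> \<open>Neighbouring positions differ in parity, and \<open>C\<close> exceeds both
    \<open>A\<close> and \<open>B\<close>.\<close>
  have step: "induced_label ?G f (path_vertex ?as i j) \<noteq> induced_label ?G f (path_vertex ?as i (Suc j))"
    if "i < 4 * l + 2" "j < ?as ! i" for i j
    using \<open>A < B\<close> \<open>B < C\<close> label[of i j] label[of i "Suc j"] that by auto
  have "induced_label ?G f x \<noteq> induced_label ?G f y" if adj: "adjacent ?G x y" for x y
  proof -
    obtain i j where "i < 4 * l + 2" "j < ?as ! i"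
      and "{x, y} = {path_vertex ?as i j, path_vertex ?as i (Suc j)}"
      using adj length_theta_lengths[of l] by (auto simp: adjacent_def bridge_graph_def)
    with step[of i j] show ?thesis by (auto simp: doubleton_eq_iff)
  qed
  moreover have "bij_betw f (edges ?G) {1..card (edges ?G)}"
    by (rule bij_betw_edges_bridge_graph[OF len f])
      (simp_all only: path_label_image sum_list_theta_lengths)
  ultimately have la: "local_antimagic ?G f"
    by (simp add: local_antimagic_def)
  have "induced_label ?G f ` verts ?G \<subseteq> {A, B, C}"
  proof (rule image_subsetI)
    fix x assume "x \<in> verts ?G"
    then show "induced_label ?G f x \<in> {A, B, C}"
      by (cases rule: verts_bridge_graph_cases) (use U C_def inner in \<open>auto simp: length_theta_lengths\<close>)
  qed
  then have "num_colors ?G f \<le> card {A, B, C}"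
    unfolding num_colors_def by (intro card_mono) auto
  also have "\<dots> \<le> 3" by (simp add: card_insert_if)
  finally have "num_colors ?G f = 3" using ge[OF la] by simp
  then show ?thesis
    unfolding chi_la_def theta_lengths_def[symmetric] using la ge by (intro cInf_eq_minimum) (auto intro!: image_eqI)
qed

end
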